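(* Let $\lambda$ be a nonzero real number. For every integer $n\ge 0$ and every real $x$ (equivalently, as an identity of polynomials in $x$ over $\mathbb{R}$), $$\beta_{n,\lambda}(x)=(x+1)_{n,\lambda}-\sum_{l=0}^{n-1}\binom{n}{l}\beta_{l,\lambda}(x)\frac{M_{n-l+1,\lambda}}{n-l+1},$$ where $\beta_{n,\lambda}(x)$ are the degenerate Bernoulli polynomials, $M_{n,\lambda}$ are the dimorphic Mersenne numbers and $(x)_{n,\lambda}$ is the degenerate falling factorial; the sum is empty (equal to $0$) when $n=0$.
   Context: Let $\lambda\in\mathbb{R}$ be nonzero. The degenerate falling factorial is $(x)_{0,\lambda}=1$ and $(x)_{n,\lambda}=x(x-\lambda)(x-2\lambda)\cdots(x-(n-1)\lambda)$ for $n\ge 1$. The degenerate exponentials are the formal power series in $t$ $$e_{\lambda}^{x}(t)=(1+\lambda t)^{x/\lambda}=\sum_{n=0}^{\infty}(x)_{n,\lambda}\frac{t^{n}}{n!},\qquad e_{\lambda}(t)=e_{\lambda}^{1}(t).$$ The degenerate Bernoulli polynomials $\beta_{n,\lambda}(x)$, $n\ge 0$, are defined by $$\frac{t}{e_{\lambda}(t)-1}e_{\lambda}^{x}(t)=\sum_{n=0}^{\infty}\beta_{n,\lambda}(x)\frac{t^{n}}{n!}.$$ The dimorphic Mersenne numbers are $M_{n,\lambda}=(2)_{n,\lambda}-(1)_{n,\lambda}$ for $n\ge 0$. *)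

theory Defs
  imports Complex_Main "HOL-Computational_Algebra.Formal_Power_Series"
begin

definition deg_ffact :: "real \<Rightarrow> real \<Rightarrow> nat \<Rightarrow> real" where
  "deg_ffact lam x n = (\<Prod>k<n. x - real k * lam)"

definition deg_exp :: "real \<Rightarrow> real \<Rightarrow> real fps" where
  "deg_exp lam x = Abs_fps (\<lambda>n. deg_ffact lam x n / fact n)"

(* The quotient is an exact one: the denominator has subdegree 1, see deg_bernoulli_gf. *)
definition deg_bernoulli :: "real \<Rightarrow> nat \<Rightarrow> real \<Rightarrow> real" where
  "deg_bernoulli lam n x =
     fact n * fps_nth (fps_X / (deg_exp lam 1 - 1) * deg_exp lam x) n"

definition dim_mersenne :: "real \<Rightarrow> nat \<Rightarrow> real" where
  "dim_mersenne lam n = deg_ffact lam 2 n - deg_ffact lam 1 n"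

lemma deg_bernoulli_gf:
  "(deg_exp lam 1 - 1) * Abs_fps (\<lambda>n. deg_bernoulli lam n x / fact n) = fps_X * deg_exp lam x"
proof -
  let ?d = "deg_exp lam 1 - 1"
  have c0: "fps_nth ?d 0 = 0" and c1: "fps_nth ?d 1 = 1"
    by (simp_all add: deg_exp_def deg_ffact_def)
  have nz: "?d \<noteq> 0" using c1 by (metis fps_zero_nth zero_neq_one)
  have "subdegree ?d = 1"
    by (rule subdegreeI) (use c0 c1 in auto)
  then have "?d dvd fps_X"
    using nz by (simp add: fps_dvd_iff)
  then have "?d * (fps_X / ?d) = fps_X"
    by (rule dvd_mult_div_cancel)
  moreover have "Abs_fps (\<lambda>n. deg_bernoulli lam n x / fact n) = fps_X / ?d * deg_exp lam x"
    by (rule fps_ext) (simp add: deg_bernoulli_def)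
  ultimately show ?thesis by (metis mult.assoc)
qed

(* deg_exp lam x is the series (1 + lam * t) powr (x / lam). *)
lemma deg_exp_eq_binomial:
  assumes "lam \<noteq> 0"
  shows "deg_exp lam x = fps_compose (fps_binomial (x / lam)) (fps_const lam * fps_X)"
proof (rule fps_ext)
  fix n
  have "(\<Prod>k<n. x - real k * lam) = (\<Prod>k<n. lam * (x / lam - real k))"
    using assms by (intro prod.cong) (auto simp: field_simps)
  then show "fps_nth (deg_exp lam x) n =
      fps_nth (fps_compose (fps_binomial (x / lam)) (fps_const lam * fps_X)) n"
    by (simp add: deg_exp_def deg_ffact_def fps_compose_linear gbinomial_prod_rev
        prod.distrib atLeast0LessThan)
qed

end

(* Write e(x) for deg_exp lam x and B for the generating function of the degenerate Bernoulli
   polynomials. Since e(2) - e(1) = (e(1) - 1) * e(1), the defining relation (e(1) - 1) * B = t * e(x)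
   gives (e(2) - e(1)) * B = t * e(x + 1). The claim is the coefficient of t^(n + 1): the Mersenne
   number of index 0 vanishes, and the one of index 1 is 1, which isolates the term l = n. *)

theory Submission
  imports Defs
begin

text \<open>By \<open>deg_exp_eq_binomial\<close> this is the exponent law for binomial series
  (Vandermonde), carried over by substituting \<open>lam * t\<close> for the variable.\<close>

lemma deg_exp_add:
  assumes "lam \<noteq> 0"
  shows "deg_exp lam (x + y) = deg_exp lam x * deg_exp lam y"
  using assms
  by (simp add: deg_exp_eq_binomial add_divide_distrib fps_binomial_add_mult
      fps_compose_mult_distrib)

lemma dim_mersenne_0: "dim_mersenne lam 0 = 0"
  by (simp add: dim_mersenne_def deg_ffact_def)

lemma dim_mersenne_1: "dim_mersenne lam 1 = 1"
  by (simp add: dim_mersenne_def deg_ffact_def)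

lemma dim_mersenne_gf:
  "Abs_fps (\<lambda>n. dim_mersenne lam n / fact n) = deg_exp lam 2 - deg_exp lam 1"
  by (rule fps_ext) (simp add: dim_mersenne_def deg_exp_def diff_divide_distrib)

lemma deg_bernoulli_mersenne_gf:
  assumes "lam \<noteq> 0"
  shows "Abs_fps (\<lambda>n. deg_bernoulli lam n x / fact n) * Abs_fps (\<lambda>n. dim_mersenne lam n / fact n)
    = fps_X * deg_exp lam (x + 1)"
proof -
  let ?B = "Abs_fps (\<lambda>n. deg_bernoulli lam n x / fact n)"
  have "deg_exp lam 2 = deg_exp lam 1 * deg_exp lam 1"
    using deg_exp_add[OF assms, of 1 1] by simp
  then have "?B * Abs_fps (\<lambda>n. dim_mersenne lam n / fact n)
      = ((deg_exp lam 1 - 1) * ?B) * deg_exp lam 1"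
    by (simp add: dim_mersenne_gf algebra_simps)
  then show ?thesis
    by (simp add: deg_bernoulli_gf deg_exp_add[OF assms] mult.assoc)
qed

lemma sum_deg_bernoulli_mersenne:
  assumes "lam \<noteq> 0"
  shows "(\<Sum>l\<le>n. real (n choose l) * deg_bernoulli lam l x *
      (dim_mersenne lam (n - l + 1) / real (n - l + 1))) = deg_ffact lam (x + 1) n"
proof -
  let ?c = "\<lambda>l. deg_bernoulli lam l x / fact l * (dim_mersenne lam (Suc n - l) / fact (Suc n - l))"
  have "(\<Sum>l\<le>Suc n. ?c l) = fps_nth (Abs_fps (\<lambda>n. deg_bernoulli lam n x / fact n) *
      Abs_fps (\<lambda>n. dim_mersenne lam n / fact n)) (Suc n)"
    by (simp add: fps_mult_nth atLeast0AtMost del: sum.atMost_Suc)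
  also have "\<dots> = deg_ffact lam (x + 1) n / fact n"
    by (simp add: deg_bernoulli_mersenne_gf[OF assms] deg_exp_def)
  finally have "(\<Sum>l\<le>Suc n. ?c l) = deg_ffact lam (x + 1) n / fact n" .
  \<comment> \<open>The term \<open>l = Suc n\<close> of the Cauchy product drops out because it
    carries the Mersenne number of index 0.\<close>
  then have "deg_ffact lam (x + 1) n = (\<Sum>l\<le>n. fact n * ?c l)"
    unfolding sum_distrib_left[symmetric] by (simp add: dim_mersenne_0 field_simps del: fact_Suc)
  also have "\<dots> = (\<Sum>l\<le>n. real (n choose l) * deg_bernoulli lam l x *
      (dim_mersenne lam (n - l + 1) / real (n - l + 1)))"
    \<comment> \<open>For \<open>l \<le> n\<close>, \<open>n! / (l! (n + 1 - l)!)\<close> equals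
      \<open>(n choose l) / (n - l + 1)\<close>; this is where the denominator of the claim comes
      from.\<close>
    by (rule sum.cong) (auto simp: binomial_fact Suc_diff_le field_simps)
  finally show ?thesis ..
qed

theorem theorem1:
  fixes lam x :: real and n :: nat
  assumes "lam \<noteq> 0"
  shows "deg_bernoulli lam n x =
    deg_ffact lam (x + 1) n -
    (\<Sum>l<n. real (n choose l) * deg_bernoulli lam l x *
            (dim_mersenne lam (n - l + 1) / real (n - l + 1)))"
  \<comment> \<open>Splitting off \<open>l = n\<close> leaves exactly
    \<open>deg_bernoulli lam n x\<close>, its coefficient being 1.\<close>
  using sum_deg_bernoulli_mersenne[OF assms, of n x] dim_mersenne_1[of lam]
  by (simp add: lessThan_Suc_atMost[symmetric])

end
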